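(* Let $m,n$ be positive integers and let $a=(a_1,\dots,a_n)$, $b=(b_1,\dots,b_n)\in\mathbb{Z}_{>0}^n$ be partitions of $m$. Let $A_j=a_1+\dots+a_j$ and $B_j=b_1+\dots+b_j$ for $1\le j\le n$, and $A_0=B_0=0$. Then the inequality $$\sum_{\sigma\in S_m}\varphi\left[\prod_{j=1}^{n}\left(\frac1{a_j}\sum_{i=A_{j-1}+1}^{A_j}X_{\sigma(i)}\right)\right]\le\sum_{\sigma\in S_m}\varphi\left[\prod_{j=1}^{n}\left(\frac1{b_j}\sum_{i=B_{j-1}+1}^{B_j}X_{\sigma(i)}\right)\right]$$ holds for all real numbers $X_1,X_2,\ldots,X_m\ge 0$ and every convex function $\varphi:[0,\infty)\to\mathbb{R}$ if and only if $a\prec_{\mathrm{maj}}b$.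
   Context: A vector $a\in\mathbb{Z}_{>0}^n$ is a partition of $m$ if its entries sum to $m$, i.e. $a_1+\dots+a_n=m$ (the entries need not be listed in any particular order). $S_m$ denotes the group of permutations of $\{1,\dots,m\}$. For $a,b\in\mathbb{R}^n$, write $a\prec_{\mathrm{maj}}b$ ($b$ majorizes $a$) if $\sum_{i=1}^j a_i^{\downarrow}\le\sum_{i=1}^j b_i^{\downarrow}$ for all $j=1,\dots,n$, with equality when $j=n$, where $a^{\downarrow}$, $b^{\downarrow}$ denote the rearrangements of $a$, $b$ in decreasing order. *)

theory Defs
  imports "HOL-Analysis.Analysis" "HOL-Combinatorics.Permutations"
begin

text \<open>
  A vector with \<open>n\<close> entries is a list of length \<open>n\<close>; its \<open>j\<close>-th entry, for \<open>1 \<le> j \<le> n\<close>,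
  is the list element at position \<open>j - 1\<close>.
\<close>

definition is_partition :: "nat \<Rightarrow> nat \<Rightarrow> nat list \<Rightarrow> bool" where
  "is_partition m n a \<longleftrightarrow> length a = n \<and> (\<forall>k\<in>set a. 0 < k) \<and> sum_list a = m"

definition decreasing :: "real list \<Rightarrow> real list" where
  "decreasing x = rev (sort x)"

definition partial_sum :: "'a::comm_monoid_add list \<Rightarrow> nat \<Rightarrow> 'a" where
  "partial_sum x j = (\<Sum>i=1..j. x ! (i - 1))"

definition majorized_by :: "real list \<Rightarrow> real list \<Rightarrow> bool" (infix \<open>\<prec>maj\<close> 50) where
  "x \<prec>maj y \<longleftrightarrow> length x = length y \<and>
     (\<forall>j\<in>{1..length x}. partial_sum (decreasing x) j \<le> partial_sum (decreasing y) j) \<and>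
     partial_sum (decreasing x) (length x) = partial_sum (decreasing y) (length y)"

text \<open>
  The product of the averages of \<open>Y\<close> over the consecutive blocks of sizes \<open>a\<close>,
  which start at index 1.
\<close>

definition block_mean_prod :: "nat list \<Rightarrow> (nat \<Rightarrow> real) \<Rightarrow> real" where
  "block_mean_prod a Y =
     (\<Prod>j=1..length a.
        1 / real (a ! (j - 1)) * (\<Sum>i=partial_sum a (j - 1) + 1..partial_sum a j. Y i))"

end

theory Submission
  imports Defs "HOL-Library.Disjoint_Sets"
begin

text \<open>
  A sum over all permutations depends only on the multiset of block sizes. To pass from block sizes
  \<open>{p, q}\<close> to \<open>{r, t}\<close> with \<open>p + q = r + t\<close> and \<open>r \<le> p, q\<close>, split the two blocks as \<open>U \<union> A\<close> and
  \<open>V \<union> B\<close> with \<open>|U| = |V| = r\<close>, and let \<open>u, v, x, y\<close> be the sums over \<open>U, V, A, B\<close>. The numbers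
  \<open>(u + x + y) v\<close> and \<open>u (v + x + y)\<close> have the same sum as \<open>(u + x) (v + y) - x y\<close> and
  \<open>(u + y) (v + x) - x y\<close> and are further apart, since \<open>|x - y| \<le> x + y\<close>. So convexity compares the
  two pairs, and Jensen's inequality for the average over all subsets \<open>A\<close> and \<open>B\<close> of the two blocks
  replaces \<open>x y\<close> by the multiple of \<open>(u + x) (v + y)\<close> that gives exactly the right normalization.
  Majorization is a chain of such moves.

  Conversely, if the \<open>j\<close> smallest parts of \<open>a\<close> have total \<open>k\<close> and those of \<open>b\<close> have a larger total,
  take \<open>k\<close> of the \<open>X\<^sub>i\<close> equal to a small \<open>\<epsilon>\<close> and the others \<open>1\<close>: some product for \<open>a\<close> is at most
  \<open>\<epsilon>\<^sup>j\<close>, while every product for \<open>b\<close> is at least a constant times \<open>\<epsilon>\<close> to the power \<open>j - 1\<close>, and a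
  hinge function \<open>\<phi>\<close> separates the two.
\<close>

subsection \<open>Permutation sums over set partitions\<close>

definition mean :: "('a \<Rightarrow> real) \<Rightarrow> 'a set \<Rightarrow> real" where
  "mean Y I = sum Y I / real (card I)"

definition shape :: "'a set set \<Rightarrow> nat multiset" where
  "shape P = image_mset card (mset_set P)"

text \<open>Stated for arbitrary set partitions instead of consecutive blocks, so that blocks can be
  cut and regrouped without keeping track of an order.\<close>

definition perm_sum :: "(real \<Rightarrow> real) \<Rightarrow> ('a \<Rightarrow> real) \<Rightarrow> 'a set \<Rightarrow> 'a set set \<Rightarrow> real" where
  "perm_sum \<phi> X M P = (\<Sum>\<sigma> | \<sigma> permutes M. \<phi> (\<Prod>I\<in>P. mean (X \<circ> \<sigma>) I))"

lemma shape_insert: "finite P \<Longrightarrow> I \<notin> P \<Longrightarrow> shape (insert I P) = add_mset (card I) (shape P)"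
  by (simp add: shape_def)

text \<open>Each block of \<open>P\<close> is matched with a block of \<open>Q\<close> of the same
  size, and bijections between matched blocks are glued; disjointness of the blocks makes the glued
  map well defined and injective.\<close>

lemma bij_betw_of_shape_eq:
  assumes "finite P" "finite Q" "disjoint P" "disjoint Q" "\<forall>I\<in>P \<union> Q. finite I"
    and "shape P = shape Q"
  shows "\<exists>\<pi>. bij_betw \<pi> (\<Union>P) (\<Union>Q) \<and> Q = (`) \<pi> ` P"
  using assms
proof (induction P arbitrary: Q rule: finite_induct)
  case empty
  then show ?case by (auto simp: shape_def mset_set_empty_iff)
next
  case (insert I P)
  have "card I \<in># shape Q"
    using insert.prems insert.hyps by (metis shape_insert union_single_eq_member)
  then obtain J where J: "J \<in> Q" "card J = card I"
    using insert.prems by (auto simp: shape_def)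
  define Q' where "Q' = Q - {J}"
  have Q: "Q = insert J Q'" "J \<notin> Q'" "finite Q'"
    using J insert.prems by (auto simp: Q'_def)
  have "shape P = shape Q'"
    using insert.prems insert.hyps J Q by (auto simp: shape_insert)
  moreover have "disjoint P" "disjoint Q'"
    using insert.prems Q by (auto simp: pairwise_insert)
  ultimately obtain \<pi> where \<pi>: "bij_betw \<pi> (\<Union>P) (\<Union>Q')" "Q' = (`) \<pi> ` P"
    using insert.IH[of Q'] insert.prems Q by auto
  obtain h where h: "bij_betw h I J"
    using finite_same_card_bij[of I J] insert.prems J by auto
  define \<rho> where "\<rho> = (\<lambda>x. if x \<in> I then h x else \<pi> x)"
  have dI: "I \<inter> \<Union>P = {}"
    using insert.prems(2) insert.hyps by (auto simp: pairwise_insert disjnt_def)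
  have dJ: "J \<inter> \<Union>Q' = {}"
    using insert.prems(3) Q by (auto simp: pairwise_insert disjnt_def)
  have \<rho>I: "bij_betw \<rho> I J"
    using h by (rule iffD1[OF bij_betw_cong, rotated]) (auto simp: \<rho>_def)
  have \<rho>P: "bij_betw \<rho> (\<Union>P) (\<Union>Q')"
    using \<pi>(1) dI by (intro iffD1[OF bij_betw_cong \<pi>(1)]) (auto simp: \<rho>_def)
  have "bij_betw \<rho> (I \<union> \<Union>P) (J \<union> \<Union>Q')"
    using \<rho>I \<rho>P dJ by (rule bij_betw_combine)
  moreover have "\<rho> ` K = \<pi> ` K" if "K \<in> P" for K
    using that dI by (intro image_cong) (auto simp: \<rho>_def)
  then have "(`) \<rho> ` P = Q'"
    using \<pi>(2) by auto
  ultimately show ?case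
    using Q \<rho>I by (intro exI[of _ \<rho>]) (auto simp: bij_betw_def)
qed

lemma partition_on_finite:
  assumes "finite M" "partition_on M P"
  shows "finite P" "\<And>I. I \<in> P \<Longrightarrow> finite I" "\<And>I. I \<in> P \<Longrightarrow> I \<subseteq> M" "\<And>I. I \<in> P \<Longrightarrow> 0 < card I"
proof -
  show "finite P"
    using assms finite_elements by blast
  show sub: "I \<subseteq> M" if "I \<in> P" for I
    using that assms by (auto simp: partition_on_def)
  then show fin: "finite I" if "I \<in> P" for I
    using that assms finite_subset by blast
  show "0 < card I" if "I \<in> P" for I
    using that assms fin[OF that] by (auto simp: partition_on_def card_gt_0_iff)
qed

text \<open>Both partitions cover \<open>M\<close>, so the glued bijection maps \<open>M\<close>
  onto itself and, extended by the identity, is a permutation. Block sizes thus determine the orbit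
  of a set partition.\<close>

lemma partition_on_conjugate:
  assumes "finite M" "partition_on M P" "partition_on M Q" "shape P = shape Q"
  obtains \<pi> where "\<pi> permutes M" "Q = (`) \<pi> ` P"
proof -
  note fin = partition_on_finite[OF assms(1,2)] partition_on_finite[OF assms(1,3)]
  have "\<exists>\<pi>. bij_betw \<pi> (\<Union>P) (\<Union>Q) \<and> Q = (`) \<pi> ` P"
    using assms fin by (intro bij_betw_of_shape_eq) (auto intro: partition_onD2)
  then obtain \<pi> where \<pi>: "bij_betw \<pi> M M" "Q = (`) \<pi> ` P"
    using partition_onD1[OF assms(2)] partition_onD1[OF assms(3)] by metis
  define \<rho> where "\<rho> = (\<lambda>x. if x \<in> M then \<pi> x else x)"
  have "bij_betw \<rho> M M"
    using \<pi>(1) by (intro iffD1[OF bij_betw_cong \<pi>(1)]) (auto simp: \<rho>_def)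
  then have "\<rho> permutes M"
    by (rule bij_imp_permutes) (auto simp: \<rho>_def)
  moreover have "\<rho> ` I = \<pi> ` I" if "I \<in> P" for I
    using fin(3)[OF that] by (intro image_cong) (auto simp: \<rho>_def)
  then have "Q = (`) \<rho> ` P"
    using \<pi>(2) by auto
  ultimately show ?thesis
    by (rule that)
qed

text \<open>A permutation \<open>\<pi>\<close> carrying \<open>P\<close> to \<open>Q\<close> is
  absorbed by the substitution of \<open>\<sigma> \<circ> \<pi>\<close> for \<open>\<sigma>\<close>
  in the sum over the whole group.\<close>

lemma perm_sum_cong_shape:
  assumes "finite M" "partition_on M P" "partition_on M Q" "shape P = shape Q"
  shows "perm_sum \<phi> X M P = perm_sum \<phi> X M Q"
proof -
  obtain \<pi> where \<pi>: "\<pi> permutes M" "Q = (`) \<pi> ` P"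
    using partition_on_conjugate[OF assms] .
  have inj: "inj \<pi>"
    using \<pi>(1) permutes_inj by blast
  have "mean Y (\<pi> ` I) = mean (Y \<circ> \<pi>) I" for Y :: "'a \<Rightarrow> real" and I
    using inj by (simp add: mean_def card_image sum.reindex inj_on_def)
  moreover have "inj_on ((`) \<pi>) P"
    using inj by (simp add: inj_image_eq_iff inj_on_def)
  ultimately have "(\<Prod>I\<in>Q. mean Y I) = (\<Prod>I\<in>P. mean (Y \<circ> \<pi>) I)" for Y :: "'a \<Rightarrow> real"
    by (simp add: \<pi>(2) prod.reindex)
  then show ?thesis
    unfolding perm_sum_def
    by (subst sum_permutations_compose_right[OF \<pi>(1)]) (simp add: comp_assoc)
qed

section \<open>Averaging over the permutations of a subset\<close>

lemma sum_permutes_sum_subset: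
  fixes Y :: "'a \<Rightarrow> real"
  assumes "finite S" "S \<noteq> {}" "A \<subseteq> S"
  shows "(\<Sum>g | g permutes S. sum (Y \<circ> g) A) / fact (card S) = card A / card S * sum Y S"
proof -
  define T where "T = (\<lambda>a. \<Sum>g | g permutes S. Y (g a))"
  \<comment> \<open>Composing with the transposition of \<open>a\<close> and \<open>b\<close> shows
    that all points of \<open>S\<close> have the same total; its value then follows from summing
    over \<open>S\<close>.\<close>
  have "T a = T b" if "a \<in> S" "b \<in> S" for a b
    unfolding T_def
    using sum_permutations_compose_right[OF permutes_swap_id[OF that], of "\<lambda>g. Y (g a)"] by simp
  then obtain t where t: "\<And>a. a \<in> S \<Longrightarrow> T a = t"
    by meson
  have "card S * t = (\<Sum>a\<in>S. T a)"
    using t by simp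
  also have "\<dots> = (\<Sum>g | g permutes S. \<Sum>a\<in>S. Y (g a))"
    unfolding T_def by (rule sum.swap)
  also have "\<dots> = (\<Sum>g | g permutes S. sum Y S)"
  proof (rule sum.cong[OF refl])
    fix g assume "g \<in> {g. g permutes S}"
    then show "(\<Sum>a\<in>S. Y (g a)) = sum Y S"
      using sum.permute[of g S Y] by (simp add: comp_def)
  qed
  also have "\<dots> = fact (card S) * sum Y S"
    using card_permutations[OF refl assms(1)] by simp
  finally have "t = fact (card S) * sum Y S / card S"
    using assms by (simp add: field_simps)
  moreover have "(\<Sum>g | g permutes S. sum (Y \<circ> g) A) = (\<Sum>a\<in>A. T a)"
    unfolding T_def by (subst sum.swap) simp
  moreover have "(\<Sum>a\<in>A. T a) = card A * t"
    using t assms(3) by (simp add: subset_iff)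
  ultimately show ?thesis by simp
qed

text \<open>Jensen's inequality over the permutations \<open>g\<close> of \<open>S\<close>: the
  invariant \<open>\<alpha>\<close> and \<open>\<beta>\<close> stay fixed, while the sum over
  \<open>A\<close> averages to its share of the sum over \<open>S\<close>. The sum over all
  \<open>\<sigma>\<close> absorbs \<open>g\<close>, and \<open>nonneg\<close> keeps every argument
  in the domain of convexity.\<close>

lemma perm_sum_average:
  fixes X :: "'a \<Rightarrow> real" and \<alpha> \<beta> :: "('a \<Rightarrow> real) \<Rightarrow> real"
  assumes "finite M" "S \<subseteq> M" "S \<noteq> {}" "A \<subseteq> S" "convex_on {0..} \<phi>"
    and inv: "\<And>Y g. g permutes S \<Longrightarrow> \<alpha> (Y \<circ> g) = \<alpha> Y" "\<And>Y g. g permutes S \<Longrightarrow> \<beta> (Y \<circ> g) = \<beta> Y"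
    and nonneg: "\<And>\<sigma>. \<sigma> permutes M \<Longrightarrow> 0 \<le> \<alpha> (X \<circ> \<sigma>) - \<beta> (X \<circ> \<sigma>) * sum (X \<circ> \<sigma>) A"
  shows "(\<Sum>\<sigma> | \<sigma> permutes M. \<phi> (\<alpha> (X \<circ> \<sigma>) - \<beta> (X \<circ> \<sigma>) * (card A / card S * sum (X \<circ> \<sigma>) S)))
    \<le> (\<Sum>\<sigma> | \<sigma> permutes M. \<phi> (\<alpha> (X \<circ> \<sigma>) - \<beta> (X \<circ> \<sigma>) * sum (X \<circ> \<sigma>) A))"
proof -
  define L where "L = (\<lambda>Y. \<alpha> Y - \<beta> Y * sum Y A)"
  have finS: "finite S"
    using assms finite_subset by blast
  have card: "real (card {g. g permutes S}) = fact (card S)"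
    using card_permutations[OF refl finS] by simp
  have finP: "finite {g. g permutes S}"
    using finite_permutations[OF finS] .
  have perm: "\<sigma> \<circ> g permutes M" if "\<sigma> permutes M" "g permutes S" for \<sigma> g
    using that permutes_compose permutes_subset assms(2) by blast
  have jensen: "\<phi> (\<alpha> Y - \<beta> Y * (card A / card S * sum Y S))
      \<le> (\<Sum>g | g permutes S. 1 / fact (card S) * \<phi> (L (Y \<circ> g)))"
    if Y: "Y = X \<circ> \<sigma>" and \<sigma>: "\<sigma> permutes M" for Y \<sigma>
  proof -
    have "\<alpha> Y - \<beta> Y * (card A / card S * sum Y S)
        = (\<Sum>g | g permutes S. (1 / fact (card S)) *\<^sub>R (\<alpha> Y - \<beta> Y * sum (Y \<circ> g) A))"
      unfolding sum_permutes_sum_subset[OF finS assms(3,4), symmetric] real_scaleR_def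
        sum_distrib_left[symmetric] sum_subtractf
      using card by (simp add: field_simps)
    also have "\<dots> = (\<Sum>g | g permutes S. (1 / fact (card S)) *\<^sub>R L (Y \<circ> g))"
      by (intro sum.cong refl) (simp add: L_def inv)
    also have "\<phi> \<dots> \<le> (\<Sum>g | g permutes S. 1 / fact (card S) * \<phi> (L (Y \<circ> g)))"
    proof (rule convex_on_sum[OF finP _ assms(5)])
      show "{g. g permutes S} \<noteq> {}"
        using permutes_id by blast
      show "L (Y \<circ> g) \<in> {0..}" if "g \<in> {g. g permutes S}" for g
        using nonneg[of "\<sigma> \<circ> g"] perm[OF \<sigma>] that by (simp add: L_def Y comp_assoc)
    qed (use card in simp_all)
    finally show ?thesis .
  qed
  have "(\<Sum>\<sigma> | \<sigma> permutes M. \<phi> (\<alpha> (X \<circ> \<sigma>) - \<beta> (X \<circ> \<sigma>) * (card A / card S * sum (X \<circ> \<sigma>) S)))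
      \<le> (\<Sum>\<sigma> | \<sigma> permutes M. \<Sum>g | g permutes S. 1 / fact (card S) * \<phi> (L (X \<circ> \<sigma> \<circ> g)))"
    by (intro sum_mono jensen) auto
  also have "\<dots> = (\<Sum>g | g permutes S. 1 / fact (card S) * (\<Sum>\<sigma> | \<sigma> permutes M. \<phi> (L (X \<circ> (\<sigma> \<circ> g)))))"
    by (subst sum.swap) (simp add: sum_distrib_left comp_assoc)
  \<comment> \<open>Each \<open>g\<close> also permutes \<open>M\<close>, so the inner sum over
    \<open>\<sigma>\<close> does not depend on \<open>g\<close>.\<close>
  also have "\<dots> = (\<Sum>g | g permutes S. 1 / fact (card S) * (\<Sum>\<sigma> | \<sigma> permutes M. \<phi> (L (X \<circ> \<sigma>))))"
    using permutes_subset[OF _ assms(2)]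
    by (intro sum.cong refl arg_cong2[where f = "(*)"] sum_permutations_compose_right[symmetric]) auto
  also have "\<dots> = (\<Sum>\<sigma> | \<sigma> permutes M. \<phi> (L (X \<circ> \<sigma>)))"
    using card by simp
  finally show ?thesis
    by (simp add: L_def)
qed

subsection \<open>Spreading two blocks\<close>

text \<open>Both \<open>c\<close> and \<open>d\<close> lie between \<open>a\<close> and
  \<open>b\<close>, with complementary weights because the sums agree. Adding the two convexity
  inequalities cancels the weights.\<close>

lemma convex_on_add_le_of_spread:
  fixes \<phi> :: "real \<Rightarrow> real"
  assumes "convex_on C \<phi>" "a \<in> C" "b \<in> C" "c + d = a + b" "\<bar>c - d\<bar> \<le> \<bar>a - b\<bar>"
  shows "\<phi> c + \<phi> d \<le> \<phi> a + \<phi> b"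
proof (cases "a = b")
  case True
  then have "c = a" "d = b" using assms(4,5) by auto
  then show ?thesis by simp
next
  case False
  define t where "t = (c - a) / (b - a)"
  have t: "0 \<le> t" "t \<le> 1"
    using False assms(4,5) unfolding t_def
    by (auto simp: zero_le_divide_iff divide_le_eq_1 abs_le_iff abs_if split: if_splits)
  have "t * (b - a) = c - a"
    using False by (simp add: t_def)
  then have "c = (1 - t) * a + t * b" "d = (1 - (1 - t)) * a + (1 - t) * b"
    using assms(4) by (auto simp: algebra_simps)
  then have "\<phi> c \<le> (1 - t) * \<phi> a + t * \<phi> b" "\<phi> d \<le> (1 - (1 - t)) * \<phi> a + (1 - t) * \<phi> b"
    using convex_onD[OF assms(1) t assms(2,3)] convex_onD[OF assms(1) _ _ assms(2,3), of "1 - t"] t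
    by simp_all
  then show ?thesis
    by (simp add: algebra_simps)
qed

lemma permutes_sum_comp:
  assumes "g permutes S" "T = S \<or> T \<inter> S = {}"
  shows "sum (Y \<circ> g) T = sum Y T"
  using assms(2)
proof
  assume "T = S"
  then show ?thesis using sum.permute[OF assms(1), of Y] by simp
next
  assume "T \<inter> S = {}"
  then show ?thesis
    by (intro sum.cong refl) (simp add: disjoint_iff permutes_not_in[OF assms(1)])
qed

text \<open>The configuration of one move: \<open>U\<close> and \<open>V\<close> are cores of equal
  size, \<open>A\<close> and \<open>B\<close> are the possibly empty excesses, and \<open>R\<close>
  holds the untouched blocks. The assumptions are symmetric in \<open>A\<close> and
  \<open>B\<close>, which permits a second interpretation with the excesses exchanged.\<close>

locale two_blocks =
  fixes M U V A B :: "'a set" and R :: "'a set set"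
  assumes fin: "finite M"
    and disj: "U \<inter> V = {}" "U \<inter> A = {}" "U \<inter> B = {}" "V \<inter> A = {}" "V \<inter> B = {}" "A \<inter> B = {}"
    and subM: "U \<subseteq> M" "V \<subseteq> M" "A \<subseteq> M" "B \<subseteq> M"
    and card_eq: "card U = card V" "0 < card U"
    and R: "partition_on (M - (U \<union> V \<union> A \<union> B)) R"
begin

definition rest :: "('a \<Rightarrow> real) \<Rightarrow> real" where
  "rest Y = (\<Prod>I\<in>R. mean Y I)"

text \<open>
  As \<open>|U| = |V|\<close>, this is both the product of the block sizes \<open>|U \<union> A \<union> B|\<close> and \<open>|V|\<close> after the move
  and \<open>|U \<union> A| |V \<union> B| - |A| |B|\<close>.
\<close>

definition denom :: real where
  "denom = card U * (card U + card A + card B)"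

lemma finUVAB: "finite U" "finite V" "finite A" "finite B"
  using fin subM by (auto intro: finite_subset)

lemma denom_pos: "0 < denom"
  using card_eq by (simp add: denom_def)

lemma rest_block: "I \<in> R \<Longrightarrow> I \<subseteq> M \<and> I \<inter> (U \<union> V \<union> A \<union> B) = {}"
  using partition_onD1[OF R] by auto

lemma rest_comp:
  assumes "g permutes S" "S \<subseteq> U \<union> V \<union> A \<union> B"
  shows "rest (Y \<circ> g) = rest Y"
  unfolding rest_def mean_def
  by (intro prod.cong refl arg_cong2[where f = "(/)"] permutes_sum_comp[OF assms(1)])
     (use rest_block assms(2) in blast)

lemma rest_nonneg:
  assumes "\<And>i. i \<in> M \<Longrightarrow> 0 \<le> Y i"
  shows "0 \<le> rest Y"
  unfolding rest_def mean_def
  using rest_block assms by (intro prod_nonneg divide_nonneg_nonneg sum_nonneg ballI) auto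

text \<open>Treats uniformly all regroupings of the four pieces into two blocks that the move
  compares.\<close>

lemma partition_insert2:
  assumes "S \<union> T = U \<union> V \<union> A \<union> B" "S \<inter> T = {}" "S \<noteq> {}" "T \<noteq> {}"
  shows "partition_on M (insert S (insert T R))"
    and "shape (insert S (insert T R)) = add_mset (card S) (add_mset (card T) (shape R))"
    and "(\<Prod>I\<in>insert S (insert T R). mean Y I) = rest Y * (sum Y S * sum Y T) / (card S * card T)"
proof -
  have finR: "finite R"
    using R fin finite_elements by blast
  have notin: "S \<notin> insert T R" "T \<notin> R"
    using rest_block[of S] rest_block[of T] assms by blast+
  show "partition_on M (insert S (insert T R))"
    using R assms subM rest_block
    by (auto simp: partition_on_def pairwise_insert disjnt_def)
  show "shape (insert S (insert T R)) = add_mset (card S) (add_mset (card T) (shape R))"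
    using finR notin by (simp add: shape_insert)
  show "(\<Prod>I\<in>insert S (insert T R). mean Y I) = rest Y * (sum Y S * sum Y T) / (card S * card T)"
    using finR notin by (simp add: rest_def mean_def)
qed

text \<open>Averaging replaces the sums over \<open>A\<close> and \<open>B\<close> by fixed
  multiples \<open>a\<close> and \<open>b\<close> of the sums over the two blocks. The factor
  \<open>1 - a * b\<close> that then remains turns \<open>1 / denom\<close> into the normalization
  of a product of two means.\<close>

lemma perm_sum_le_average:
  assumes conv: "convex_on {0..} \<phi>" and X: "\<And>i. i \<in> M \<Longrightarrow> 0 \<le> X i"
  shows "perm_sum \<phi> X M (insert (U \<union> A) (insert (V \<union> B) R))
    \<le> (\<Sum>\<sigma> | \<sigma> permutes M. \<phi> (rest (X \<circ> \<sigma>) *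
        (sum (X \<circ> \<sigma>) (U \<union> A) * sum (X \<circ> \<sigma>) (V \<union> B) - sum (X \<circ> \<sigma>) A * sum (X \<circ> \<sigma>) B) / denom))"
proof -
  let ?S = "U \<union> A" and ?T = "V \<union> B"
  define a b where "a = real (card A) / card ?S" and "b = real (card B) / card ?T"
  \<comment> \<open>The sums over \<open>B\<close> and \<open>A\<close> are averaged one at a time.
    \<open>\<gamma>\<close> is the coefficient of the sum over \<open>B\<close> while that over
    \<open>A\<close> is in averaged form, hence invariant under permutations of \<open>?T\<close>;
    \<open>\<beta>\<close> is the coefficient of the sum over \<open>A\<close> once that over
    \<open>B\<close> is restored, invariant under permutations of \<open>?S\<close>.\<close>
  define \<alpha> where "\<alpha> = (\<lambda>Y. rest Y * (sum Y ?S * sum Y ?T) / denom)"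
  define \<beta> where "\<beta> = (\<lambda>Y. rest Y * sum Y B / denom)"
  define \<gamma> where "\<gamma> = (\<lambda>Y. rest Y * (a * sum Y ?S) / denom)"
  have ST: "?S \<inter> ?T = {}" "?S \<union> ?T = U \<union> V \<union> A \<union> B" "?S \<noteq> {}" "?T \<noteq> {}"
    using disj card_eq by auto
  have card: "card ?S = card U + card A" "card ?T = card U + card B"
    using disj finUVAB card_eq by (auto simp: card_Un_disjoint)
  have a: "0 \<le> a" "a \<le> 1"
    using card card_eq by (auto simp: a_def divide_le_eq)
  have pos: "0 \<le> (X \<circ> \<sigma>) i" if "\<sigma> permutes M" "i \<in> M" for \<sigma> i
    using that(2) X by (simp add: permutes_in_image[OF that(1)])
  have nonneg: "0 \<le> sum (X \<circ> \<sigma>) W" if "\<sigma> permutes M" "W \<subseteq> M" for \<sigma> W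
    using pos[OF that(1)] that(2) by (intro sum_nonneg) blast
  have rest0: "0 \<le> rest (X \<circ> \<sigma>)" if "\<sigma> permutes M" for \<sigma>
    using pos[OF that] by (rule rest_nonneg)
  have sums: "sum Y ?S = sum Y U + sum Y A" "sum Y ?T = sum Y V + sum Y B" for Y :: "'a \<Rightarrow> real"
    using disj finUVAB by (auto simp: sum.union_disjoint)
  have ab: "(1 - a * b) / denom = 1 / (real (card ?S) * card ?T)"
  proof -
    have "denom = real (card ?S) * card ?T - real (card A) * card B"
      by (simp add: denom_def card algebra_simps)
    moreover have "a * b = real (card A) * card B / (real (card ?S) * card ?T)"
      by (simp add: a_def b_def)
    moreover have "real (card ?S) * card ?T \<noteq> 0"
      using card card_eq by simp
    ultimately have "1 - a * b = denom / (real (card ?S) * card ?T)"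
      by (simp add: diff_divide_distrib)
    then show ?thesis
      using denom_pos by simp
  qed
  have val: "\<alpha> Y - \<gamma> Y * (b * sum Y ?T) = rest Y * (sum Y ?S * sum Y ?T) / (real (card ?S) * card ?T)"
    for Y
  proof -
    have "\<alpha> Y - \<gamma> Y * (b * sum Y ?T) = rest Y * (sum Y ?S * sum Y ?T) * ((1 - a * b) / denom)"
      by (simp add: \<alpha>_def \<gamma>_def algebra_simps diff_divide_distrib)
    with ab show ?thesis by simp
  qed
  have "perm_sum \<phi> X M (insert ?S (insert ?T R))
      = (\<Sum>\<sigma> | \<sigma> permutes M. \<phi> (\<alpha> (X \<circ> \<sigma>) - \<gamma> (X \<circ> \<sigma>) * (b * sum (X \<circ> \<sigma>) ?T)))"
    unfolding perm_sum_def val by (simp add: partition_insert2(3)[OF ST(2,1,3,4)])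
  also have "\<dots> \<le> (\<Sum>\<sigma> | \<sigma> permutes M. \<phi> (\<alpha> (X \<circ> \<sigma>) - \<gamma> (X \<circ> \<sigma>) * sum (X \<circ> \<sigma>) B))"
    unfolding b_def
  proof (rule perm_sum_average[OF fin _ _ _ conv])
    show "?T \<subseteq> M" "?T \<noteq> {}" "B \<subseteq> ?T"
      using subM ST by auto
    show "\<alpha> (Y \<circ> g) = \<alpha> Y" "\<gamma> (Y \<circ> g) = \<gamma> Y" if "g permutes ?T" for Y g
    proof -
      have "rest (Y \<circ> g) = rest Y" "sum (Y \<circ> g) ?S = sum Y ?S" "sum (Y \<circ> g) ?T = sum Y ?T"
        using rest_comp[OF that, of Y] permutes_sum_comp[OF that, of ?S Y] permutes_sum_comp[OF that, of ?T Y] ST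
        by blast+
      then show "\<alpha> (Y \<circ> g) = \<alpha> Y" "\<gamma> (Y \<circ> g) = \<gamma> Y"
        by (simp_all only: \<alpha>_def \<gamma>_def)
    qed
    show "0 \<le> \<alpha> (X \<circ> \<sigma>) - \<gamma> (X \<circ> \<sigma>) * sum (X \<circ> \<sigma>) B" if \<sigma>: "\<sigma> permutes M" for \<sigma>
    proof -
      have "a * sum (X \<circ> \<sigma>) ?S * sum (X \<circ> \<sigma>) B \<le> 1 * sum (X \<circ> \<sigma>) ?S * sum (X \<circ> \<sigma>) ?T"
        using a nonneg[OF \<sigma>] subM
        by (intro mult_mono) (auto simp: sums intro!: mult_nonneg_nonneg add_nonneg_nonneg)
      then have "rest (X \<circ> \<sigma>) * (a * sum (X \<circ> \<sigma>) ?S * sum (X \<circ> \<sigma>) B) / denom \<le> \<alpha> (X \<circ> \<sigma>)"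
        unfolding \<alpha>_def using rest0[OF \<sigma>] denom_pos
        by (intro divide_right_mono mult_left_mono) auto
      then show ?thesis by (simp add: \<gamma>_def algebra_simps)
    qed
  qed
  also have "\<dots> = (\<Sum>\<sigma> | \<sigma> permutes M. \<phi> (\<alpha> (X \<circ> \<sigma>) - \<beta> (X \<circ> \<sigma>) * (a * sum (X \<circ> \<sigma>) ?S)))"
    by (simp add: \<beta>_def \<gamma>_def mult_ac)
  also have "\<dots> \<le> (\<Sum>\<sigma> | \<sigma> permutes M. \<phi> (\<alpha> (X \<circ> \<sigma>) - \<beta> (X \<circ> \<sigma>) * sum (X \<circ> \<sigma>) A))"
    unfolding a_def
  proof (rule perm_sum_average[OF fin _ _ _ conv])
    show "?S \<subseteq> M" "?S \<noteq> {}" "A \<subseteq> ?S"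
      using subM ST by auto
    show "\<alpha> (Y \<circ> g) = \<alpha> Y" "\<beta> (Y \<circ> g) = \<beta> Y" if "g permutes ?S" for Y g
    proof -
      have "B \<inter> ?S = {}" "?T \<inter> ?S = {}" using disj by auto
      then have "rest (Y \<circ> g) = rest Y" "sum (Y \<circ> g) ?S = sum Y ?S" "sum (Y \<circ> g) ?T = sum Y ?T"
        "sum (Y \<circ> g) B = sum Y B"
        using rest_comp[OF that, of Y] permutes_sum_comp[OF that, of ?S Y] permutes_sum_comp[OF that, of ?T Y]
          permutes_sum_comp[OF that, of B Y] by blast+
      then show "\<alpha> (Y \<circ> g) = \<alpha> Y" "\<beta> (Y \<circ> g) = \<beta> Y"
        by (simp_all only: \<alpha>_def \<beta>_def)
    qed
    show "0 \<le> \<alpha> (X \<circ> \<sigma>) - \<beta> (X \<circ> \<sigma>) * sum (X \<circ> \<sigma>) A" if \<sigma>: "\<sigma> permutes M" for \<sigma>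
    proof -
      have "sum (X \<circ> \<sigma>) A * sum (X \<circ> \<sigma>) B \<le> sum (X \<circ> \<sigma>) ?S * sum (X \<circ> \<sigma>) ?T"
        using nonneg[OF \<sigma>] subM by (intro mult_mono) (auto simp: sums)
      then have "rest (X \<circ> \<sigma>) * (sum (X \<circ> \<sigma>) A * sum (X \<circ> \<sigma>) B) / denom \<le> \<alpha> (X \<circ> \<sigma>)"
        unfolding \<alpha>_def using rest0[OF \<sigma>] denom_pos
        by (intro divide_right_mono mult_left_mono) auto
      then show ?thesis by (simp add: \<beta>_def mult_ac)
    qed
  qed
  also have "\<dots> = (\<Sum>\<sigma> | \<sigma> permutes M. \<phi> (rest (X \<circ> \<sigma>) *
        (sum (X \<circ> \<sigma>) ?S * sum (X \<circ> \<sigma>) ?T - sum (X \<circ> \<sigma>) A * sum (X \<circ> \<sigma>) B) / denom))"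
    by (simp add: \<alpha>_def \<beta>_def diff_divide_distrib algebra_simps)
  finally show ?thesis .
qed

text \<open>Exchanging the excesses, or giving both to the other core, does not change the block
  sizes. Each side can therefore be doubled, and the two resulting pairs of values are compared
  pointwise.\<close>

lemma perm_sum_spread_le:
  assumes conv: "convex_on {0..} \<phi>" and X: "\<And>i. i \<in> M \<Longrightarrow> 0 \<le> X i"
  shows "perm_sum \<phi> X M (insert (U \<union> A) (insert (V \<union> B) R))
    \<le> perm_sum \<phi> X M (insert (U \<union> A \<union> B) (insert V R))"
proof -
  interpret swap: two_blocks M U V B A R
    using fin disj subM card_eq R by unfold_locales (auto simp: Un_ac)
  have UV: "U \<noteq> {}" "V \<noteq> {}"
    using card_eq by auto
  have card: "card (U \<union> A) = card U + card A" "card (V \<union> B) = card U + card B"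
    "card (U \<union> B) = card U + card B" "card (V \<union> A) = card U + card A"
    "card (U \<union> A \<union> B) = card U + card A + card B" "card (V \<union> A \<union> B) = card U + card A + card B"
    using disj finUVAB card_eq by (auto simp: card_Un_disjoint Int_Un_distrib2)
  have sums: "sum Y (U \<union> A) = sum Y U + sum Y A" "sum Y (V \<union> B) = sum Y V + sum Y B"
    "sum Y (U \<union> B) = sum Y U + sum Y B" "sum Y (V \<union> A) = sum Y V + sum Y A"
    "sum Y (U \<union> A \<union> B) = sum Y U + sum Y A + sum Y B"
    "sum Y (V \<union> A \<union> B) = sum Y V + sum Y A + sum Y B" for Y :: "'a \<Rightarrow> real"
    using disj finUVAB by (auto simp: sum.union_disjoint Int_Un_distrib2)
  let ?P1 = "insert (U \<union> A) (insert (V \<union> B) R)" and ?P2 = "insert (U \<union> B) (insert (V \<union> A) R)"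
  let ?Q1 = "insert (U \<union> A \<union> B) (insert V R)" and ?Q2 = "insert U (insert (V \<union> A \<union> B) R)"
  have sets: "(U \<union> A) \<union> (V \<union> B) = U \<union> V \<union> A \<union> B" "(U \<union> A) \<inter> (V \<union> B) = {}" "U \<union> A \<noteq> {}" "V \<union> B \<noteq> {}"
    "(U \<union> B) \<union> (V \<union> A) = U \<union> V \<union> A \<union> B" "(U \<union> B) \<inter> (V \<union> A) = {}" "U \<union> B \<noteq> {}" "V \<union> A \<noteq> {}"
    "(U \<union> A \<union> B) \<union> V = U \<union> V \<union> A \<union> B" "(U \<union> A \<union> B) \<inter> V = {}" "U \<union> A \<union> B \<noteq> {}"
    "U \<union> (V \<union> A \<union> B) = U \<union> V \<union> A \<union> B" "U \<inter> (V \<union> A \<union> B) = {}" "V \<union> A \<union> B \<noteq> {}"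
    using disj UV by blast+
  note P1 = partition_insert2[OF sets(1-4)] and P2 = partition_insert2[OF sets(5-8)]
    and Q1 = partition_insert2[OF sets(9-11) UV(2)] and Q2 = partition_insert2[OF sets(12,13) UV(1) sets(14)]
  have denom_swap: "swap.denom = denom"
    by (simp add: denom_def swap.denom_def add_ac)
  have P12: "perm_sum \<phi> X M ?P2 = perm_sum \<phi> X M ?P1"
    using P1 P2 card by (intro perm_sum_cong_shape fin) auto
  have Q12: "perm_sum \<phi> X M ?Q2 = perm_sum \<phi> X M ?Q1"
    using Q1 Q2 card card_eq by (intro perm_sum_cong_shape fin) auto
  define f1 where "f1 = (\<lambda>Y. rest Y * (sum Y (U \<union> A) * sum Y (V \<union> B) - sum Y A * sum Y B) / denom)"
  define f2 where "f2 = (\<lambda>Y. rest Y * (sum Y (U \<union> B) * sum Y (V \<union> A) - sum Y B * sum Y A) / denom)"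
  define h1 where "h1 = (\<lambda>Y. rest Y * (sum Y (U \<union> A \<union> B) * sum Y V) / denom)"
  define h2 where "h2 = (\<lambda>Y. rest Y * (sum Y U * sum Y (V \<union> A \<union> B)) / denom)"
  have pointwise: "\<phi> (f1 Y) + \<phi> (f2 Y) \<le> \<phi> (h1 Y) + \<phi> (h2 Y)" if Y: "\<And>i. i \<in> M \<Longrightarrow> 0 \<le> Y i" for Y
  proof -
    define u v x y where "u = sum Y U" and "v = sum Y V" and "x = sum Y A" and "y = sum Y B"
    have nonneg: "0 \<le> u" "0 \<le> v" "0 \<le> x" "0 \<le> y"
      using Y subM by (auto simp: u_def v_def x_def y_def intro!: sum_nonneg)
    define k where "k = rest Y / denom"
    have k: "0 \<le> k"
      using rest_nonneg[OF Y] denom_pos by (simp add: k_def)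
    have eqs: "f1 Y = k * ((u + x) * (v + y) - x * y)" "f2 Y = k * ((u + y) * (v + x) - y * x)"
      "h1 Y = k * ((u + x + y) * v)" "h2 Y = k * (u * (v + x + y))"
      by (simp_all add: f1_def f2_def h1_def h2_def k_def sums u_def v_def x_def y_def)
    \<comment> \<open>The gaps within the two pairs differ only in the factors \<open>x - y\<close>
      and \<open>x + y\<close>.\<close>
    have "f1 Y - f2 Y = k * (x - y) * (v - u)" "h1 Y - h2 Y = k * (x + y) * (v - u)"
      by (simp_all add: eqs algebra_simps)
    moreover have "\<bar>x - y\<bar> \<le> x + y"
      using nonneg by simp
    ultimately have "\<bar>f1 Y - f2 Y\<bar> \<le> \<bar>h1 Y - h2 Y\<bar>"
      using k nonneg by (simp add: abs_mult mult_left_mono mult_right_mono)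
    moreover have "f1 Y + f2 Y = h1 Y + h2 Y"
      by (simp add: eqs algebra_simps)
    moreover have "h1 Y \<in> {0..}" "h2 Y \<in> {0..}"
      using k nonneg by (auto simp: eqs)
    ultimately show ?thesis
      by (intro convex_on_add_le_of_spread[OF conv])
  qed
  have denom_eq: "real (card (U \<union> A \<union> B) * card V) = denom" "real (card U * card (V \<union> A \<union> B)) = denom"
    using card card_eq by (simp_all add: denom_def)
  have "2 * perm_sum \<phi> X M ?P1 = perm_sum \<phi> X M ?P1 + perm_sum \<phi> X M ?P2"
    by (simp add: P12)
  also have "\<dots> \<le> (\<Sum>\<sigma> | \<sigma> permutes M. \<phi> (f1 (X \<circ> \<sigma>))) + (\<Sum>\<sigma> | \<sigma> permutes M. \<phi> (f2 (X \<circ> \<sigma>)))"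
    unfolding f1_def f2_def
    by (rule add_mono[OF perm_sum_le_average[OF assms] swap.perm_sum_le_average[OF assms, unfolded denom_swap]])
  also have "\<dots> = (\<Sum>\<sigma> | \<sigma> permutes M. \<phi> (f1 (X \<circ> \<sigma>)) + \<phi> (f2 (X \<circ> \<sigma>)))"
    by (simp add: sum.distrib)
  also have "\<dots> \<le> (\<Sum>\<sigma> | \<sigma> permutes M. \<phi> (h1 (X \<circ> \<sigma>)) + \<phi> (h2 (X \<circ> \<sigma>)))"
  proof (intro sum_mono pointwise)
    fix \<sigma> i assume "\<sigma> \<in> {\<sigma>. \<sigma> permutes M}" "i \<in> M"
    then show "0 \<le> (X \<circ> \<sigma>) i"
      using X by (simp add: permutes_in_image)
  qed
  also have "\<dots> = perm_sum \<phi> X M ?Q1 + perm_sum \<phi> X M ?Q2"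
    unfolding perm_sum_def Q1(3) Q2(3) h1_def h2_def by (simp only: sum.distrib denom_eq)
  also have "\<dots> = 2 * perm_sum \<phi> X M ?Q1"
    by (simp add: Q12)
  finally show ?thesis by simp
qed

end

text \<open>From \<open>r \<le> p\<close> and \<open>r \<le> q\<close> it follows that
  \<open>t\<close> is at least both \<open>p\<close> and \<open>q\<close>, so a step moves the two
  parts apart, or leaves them as they are. The condition \<open>0 < r\<close> keeps the cores
  nonempty.\<close>

inductive spread :: "nat multiset \<Rightarrow> nat multiset \<Rightarrow> bool" where
  "0 < r \<Longrightarrow> r \<le> p \<Longrightarrow> r \<le> q \<Longrightarrow> p + q = r + t \<Longrightarrow>
    spread (add_mset p (add_mset q N)) (add_mset r (add_mset t N))"

lemma shape_eq_add_mset: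
  assumes "finite P" "shape P = add_mset p N"
  obtains I where "I \<in> P" "card I = p" "shape (P - {I}) = N"
proof -
  have "p \<in># shape P"
    using assms by simp
  then obtain I where I: "I \<in> P" "card I = p"
    using assms(1) by (auto simp: shape_def)
  then have "shape (P - {I}) = N"
    using assms shape_insert[of "P - {I}" I] by (simp add: insert_absorb)
  with I show ?thesis by (rule that)
qed

text \<open>The step is carried out on actual blocks: cores of size \<open>r\<close> are cut from
  blocks of sizes \<open>p\<close> and \<open>q\<close>, and both excesses go to one core. The
  result need not be \<open>Q\<close>, but it has the same shape.\<close>

lemma perm_sum_mono_spread:
  assumes "spread S T" "finite M" "partition_on M P" "partition_on M Q" "shape P = S" "shape Q = T"
    and "convex_on {0..} \<phi>" "\<And>i. i \<in> M \<Longrightarrow> 0 \<le> X i"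
  shows "perm_sum \<phi> X M P \<le> perm_sum \<phi> X M Q"
  using assms(1)
proof cases
  case (1 r p q t N)
  note finP = partition_on_finite[OF assms(2,3)]
  obtain I where I: "I \<in> P" "card I = p" "shape (P - {I}) = add_mset q N"
    using shape_eq_add_mset[of P] finP assms(5) 1(1) by metis
  obtain J where J: "J \<in> P - {I}" "card J = q" "shape (P - {I} - {J}) = N"
    using shape_eq_add_mset[of "P - {I}"] finP I(3) by (metis finite_Diff)
  have IJ: "I \<inter> J = {}"
    using I J partition_onD2[OF assms(3)] by (auto dest: disjointD)
  obtain U where U: "U \<subseteq> I" "card U = r"
    using obtain_subset_with_card_n[of r I] I 1 by metis
  obtain V where V: "V \<subseteq> J" "card V = r"
    using obtain_subset_with_card_n[of r J] J 1 by metis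
  define A B R where "A = I - U" and "B = J - V" and "R = P - {I} - {J}"
  have PR: "P = insert I (insert J R)"
    using I J by (auto simp: R_def)
  have IU: "I = U \<union> A" "J = V \<union> B"
    using U V by (auto simp: A_def B_def)
  have "partition_on (M - (I \<union> J)) R"
  proof -
    have "I \<inter> K = {}" "J \<inter> K = {}" if "K \<in> R" for K
      using that I J partition_onD2[OF assms(3)] by (auto simp: R_def dest: disjointD)
    moreover have "M = I \<union> J \<union> \<Union>R"
      using partition_onD1[OF assms(3)] PR by auto
    ultimately have "\<Union>R = M - (I \<union> J)"
      by blast
    then show ?thesis
      using assms(3) by (auto simp: partition_on_def R_def intro: pairwise_subset)
  qed
  moreover have "I \<subseteq> M" "J \<subseteq> M"
    using I J finP(3) by auto
  moreover have "U \<union> V \<union> A \<union> B = I \<union> J"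
    using IU by auto
  ultimately interpret two_blocks M U V A B R
    using assms(2) IJ U V 1(3)
    by unfold_locales (auto simp: A_def B_def)
  have "card I = card U + card A" "card J = card V + card B"
    using IU finUVAB disj by (auto simp: card_Un_disjoint)
  moreover have "card (U \<union> A \<union> B) = card U + card A + card B"
    using finUVAB disj by (simp add: card_Un_disjoint Int_Un_distrib2)
  ultimately have "card (U \<union> A \<union> B) = t"
    using I(2) J(2) U(2) V(2) 1 by simp
  moreover have "U \<union> A \<union> B \<noteq> {}" "V \<noteq> {}"
    using U(2) V(2) 1(3) by auto
  moreover have "U \<union> A \<union> B \<union> V = U \<union> V \<union> A \<union> B" "(U \<union> A \<union> B) \<inter> V = {}"
    using disj by blast+
  ultimately have Q': "partition_on M (insert (U \<union> A \<union> B) (insert V R))"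
    "shape (insert (U \<union> A \<union> B) (insert V R)) = T"
    using partition_insert2[of "U \<union> A \<union> B" V] V(2) 1(2) J(3) by (simp_all add: R_def add_mset_commute)
  have "perm_sum \<phi> X M P \<le> perm_sum \<phi> X M (insert (U \<union> A \<union> B) (insert V R))"
    using perm_sum_spread_le[OF assms(7,8)] PR IU by simp
  also have "\<dots> = perm_sum \<phi> X M Q"
    using assms Q' by (intro perm_sum_cong_shape) auto
  finally show ?thesis .
qed

subsection \<open>Majorization as a chain of spreads\<close>

lemma sum_list_le_mult: "\<forall>y\<in>set xs. y \<le> x \<Longrightarrow> sum_list xs \<le> length xs * (x::nat)"
  by (induction xs) auto

lemma mult_le_sum_list: "\<forall>y\<in>set xs. x \<le> y \<Longrightarrow> length xs * (x::nat) \<le> sum_list xs"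
  by (induction xs) auto

lemma mset_take_subseteq: "mset (take k xs) \<subseteq># mset xs"
  by (metis append_take_drop_id mset_append mset_subset_eq_add_left)

text \<open>Remove the least entry \<open>x\<close> from \<open>C\<close> if it occurs there, and
  otherwise any element \<open>y\<close>, which is at least \<open>x\<close>; the rest of
  \<open>C\<close> lies in the tail of the list.\<close>

lemma sum_list_take_sorted_le:
  fixes xs :: "nat list"
  assumes "sorted xs" "C \<subseteq># mset xs"
  shows "sum_list (take (size C) xs) \<le> sum_mset C"
  using assms
proof (induction xs arbitrary: C)
  case Nil
  then show ?case by simp
next
  case (Cons x xs)
  show ?case
  proof (cases "C = {#}")
    case False
    obtain y C' where C: "C = add_mset y C'" "x \<le> y" "C' \<subseteq># mset xs"
    proof (cases "x \<in># C")
      case True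
      then obtain C' where "C = add_mset x C'"
        by (meson multi_member_split)
      then show ?thesis
        using Cons.prems(2) that[of x C'] by simp
    next
      case x: False
      obtain y where "y \<in># C"
        using False by auto
      then obtain C' where C: "C = add_mset y C'"
        by (meson multi_member_split)
      have sub: "C \<subseteq># mset xs"
      proof (rule mset_subset_eqI)
        fix w show "count C w \<le> count (mset xs) w"
          using mset_subset_eq_count[OF Cons.prems(2), of w] x by (cases "w = x") (auto simp: not_in_iff)
      qed
      then have "y \<in> set xs"
        using C mset_subset_eqD[OF sub, of y] by simp
      then have "x \<le> y"
        using Cons.prems(1) by simp
      moreover have "C' \<subseteq># mset xs"
        using sub unfolding C by (rule subset_mset.order_trans[rotated]) simp
      ultimately show ?thesis
        using C that by blast
    qed
    then show ?thesis
      using Cons.IH[of C'] Cons.prems by (simp add: add_mono)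
  qed simp
qed

lemma spread_add_mset: "spread S T \<Longrightarrow> spread (add_mset x S) (add_mset x T)"
  by (induction rule: spread.induct) (metis add_mset_commute spread.intros)

lemma rtranclp_spread_add_mset: "spread\<^sup>*\<^sup>* S T \<Longrightarrow> spread\<^sup>*\<^sup>* (add_mset x S) (add_mset x T)"
  by (induction rule: rtranclp_induct) (auto intro: rtranclp.rtrancl_into_rtrancl spread_add_mset)

text \<open>Induction on the smallest part \<open>x\<close> of \<open>a\<close>. If the least
  element \<open>y\<close> of \<open>B\<close> equals \<open>x\<close>, both are dropped. Otherwise
  a last step is undone: \<open>y\<close> and some \<open>z \<ge> x\<close> are replaced by
  \<open>x\<close> and \<open>y + z - x\<close>, and \<open>x\<close> is dropped. The hypothesis
  asks only for some \<open>C\<close>, since the list after the replacement need not be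
  sorted.\<close>

lemma rtranclp_spread_if_smallest_sums_le:
  assumes "sorted a" "size B = length a" "sum_mset B = sum_list a" "0 \<notin># B"
    and "\<And>k. k \<le> length a \<Longrightarrow> \<exists>C. C \<subseteq># B \<and> size C = k \<and> sum_mset C \<le> sum_list (take k a)"
  shows "spread\<^sup>*\<^sup>* (mset a) B"
  using assms
proof (induction a arbitrary: B)
  case Nil
  then show ?case by simp
next
  case (Cons x a)
  define b where "b = sorted_list_of_multiset B"
  have b: "sorted b" "mset b = B" "length b = Suc (length a)" "sum_list b = x + sum_list a"
    using Cons.prems(2,3) by (auto simp: b_def simp flip: size_mset sum_mset_sum_list)
  have take: "sum_list (take k b) \<le> sum_list (take k (x # a))" if "k \<le> Suc (length a)" for k
    using Cons.prems(5)[of k] that sum_list_take_sorted_le[OF b(1)] b(2)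
    by (metis le_trans length_Cons)
  obtain y b' where yb: "b = y # b'"
    using b(3) by (cases b) auto
  have "y \<le> x"
    using take[of 1] yb by simp
  show ?case
  proof (cases "y = x")
    case True
    have "spread\<^sup>*\<^sup>* (mset a) (mset b')"
    proof (rule Cons.IH)
      show "\<exists>C. C \<subseteq># mset b' \<and> size C = k \<and> sum_mset C \<le> sum_list (take k a)"
        if "k \<le> length a" for k
        using take[of "Suc k"] that b(3) yb True
        by (intro exI[of _ "mset (take k b')"]) (auto simp: mset_take_subseteq sum_mset_sum_list)
    qed (use Cons.prems b yb True in \<open>auto simp: sum_mset_sum_list\<close>)
    then show ?thesis
      using rtranclp_spread_add_mset[of "mset a" "mset b'" x] b(2) yb True by auto
  next
    case False
    with \<open>y \<le> x\<close> have yx: "y < x" by simp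
    \<comment> \<open>If all of \<open>b'\<close> were below \<open>x\<close>, then
      \<open>y < x\<close> and the entries of \<open>a\<close>, all at least \<open>x\<close>, would
      make the totals differ.\<close>
    have "\<exists>z\<in>set b'. x \<le> z"
    proof (rule ccontr)
      assume "\<not> ?thesis"
      then have "sum_list b' \<le> length b' * x"
        by (intro sum_list_le_mult) auto
      moreover have "length a * x \<le> sum_list a"
        using Cons.prems(1) by (intro mult_le_sum_list) auto
      ultimately show False
        using b(3,4) yb yx by simp
    qed
    \<comment> \<open>Choosing the first such \<open>z\<close> keeps all of \<open>L\<close> below
      \<open>x\<close>, which settles the prefixes that end inside \<open>L\<close>.\<close>
    then obtain L z G where LG: "b' = L @ z # G" "x \<le> z" "\<forall>l\<in>set L. \<not> x \<le> l"
      using split_list_first_prop[of b' "\<lambda>z. x \<le> z"] by metis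
    define c where "c = L @ (y + z - x) # G"
    have "spread\<^sup>*\<^sup>* (mset a) (mset c)"
    proof (rule Cons.IH)
      show "\<exists>C. C \<subseteq># mset c \<and> size C = k \<and> sum_mset C \<le> sum_list (take k a)"
        if k: "k \<le> length a" for k
      proof (intro exI[of _ "mset (take k c)"] conjI)
        show "mset (take k c) \<subseteq># mset c"
          by (rule mset_take_subseteq)
        show "size (mset (take k c)) = k"
          using k b(3) yb LG by (simp add: c_def)
        show "sum_mset (mset (take k c)) \<le> sum_list (take k a)"
        proof (cases "k \<le> length L")
          case True
          have "sum_list (take k L) \<le> length (take k L) * x"
            using LG(3) by (intro sum_list_le_mult) (auto dest!: in_set_takeD)
          also have "\<dots> \<le> length (take k a) * x"
            using True k by simp
          also have "\<dots> \<le> sum_list (take k a)"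
            using Cons.prems(1) by (intro mult_le_sum_list) (auto dest!: in_set_takeD)
          finally show ?thesis
            using True by (simp add: c_def sum_mset_sum_list)
        next
          case False
          then obtain i where i: "k - length L = Suc i"
            by (metis Suc_diff_Suc not_le)
          \<comment> \<open>A prefix of \<open>c\<close> that contains the new entry is smaller by
            exactly \<open>x\<close> than the prefix of \<open>b\<close> with one more entry, so the
            hypothesis for \<open>Suc k\<close> gives the bound for \<open>k\<close>.\<close>
          have "sum_list (take (Suc k) b) = y + (sum_list L + (z + sum_list (take i G)))"
            using False i yb LG(1) by simp
          moreover have "sum_list (take k c) = sum_list L + (y + z - x + sum_list (take i G))"
            using False i by (simp add: c_def)
          ultimately show ?thesis
            using take[of "Suc k"] k LG(2) by (simp add: sum_mset_sum_list)
        qed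
      qed
      show "0 \<notin># mset c"
        using Cons.prems(4) b(2) yb LG by (auto simp: c_def)
    qed (use Cons.prems b yb LG in \<open>auto simp: sum_mset_sum_list c_def\<close>)
    then have "spread\<^sup>*\<^sup>* (mset (x # a)) (add_mset x (add_mset (y + z - x) (mset (L @ G))))"
      using rtranclp_spread_add_mset[of "mset a" "mset c" x] by (simp add: c_def)
    moreover have "spread (add_mset x (add_mset (y + z - x) (mset (L @ G))))
        (add_mset y (add_mset z (mset (L @ G))))"
      using Cons.prems(4) b(2) yb LG yx by (intro spread.intros) auto
    moreover have "add_mset y (add_mset z (mset (L @ G))) = B"
      using b(2) yb LG by auto
    ultimately show ?thesis
      by (metis rtranclp.rtrancl_into_rtrancl)
  qed
qed

section \<open>Majorization through sums of the smallest parts\<close>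

lemma partial_sum_eq_sum_list_take: "j \<le> length x \<Longrightarrow> partial_sum x j = sum_list (take j x)"
proof -
  assume j: "j \<le> length x"
  have "partial_sum x j = (\<Sum>i<j. x ! i)"
    unfolding partial_sum_def by (rule sum.reindex_bij_witness[of _ Suc "\<lambda>i. i - 1"]) auto
  also have "\<dots> = sum_list (take j x)"
    using j by (simp add: sum_list_sum_nth atLeast0LessThan)
  finally show ?thesis .
qed

lemma decreasing_map_real: "decreasing (map real a) = map real (rev (sort a))"
proof -
  have "sort (map real a) = map real (sort a)"
    by (rule properties_for_sort) (simp_all add: sorted_map)
  then show ?thesis
    by (simp add: decreasing_def rev_map)
qed

lemma partial_sum_decreasing:
  assumes "j \<le> length a"
  shows "partial_sum (decreasing (map real a)) j
    = real (sum_list a) - real (sum_list (take (length a - j) (sort a)))"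
proof -
  have "sum_list (take (length a - j) (sort a)) + sum_list (drop (length a - j) (sort a)) = sum_list a"
    by (metis append_take_drop_id mset_sort sum_list_append sum_mset_sum_list)
  moreover have "partial_sum (decreasing (map real a)) j = real (sum_list (drop (length a - j) (sort a)))"
  proof -
    have "partial_sum (decreasing (map real a)) j = sum_list (map real (take j (rev (sort a))))"
      using assms by (simp only: decreasing_map_real partial_sum_eq_sum_list_take take_map length_map length_rev length_sort)
    also have "\<dots> = real (sum_list (take j (rev (sort a))))"
      by (rule sum_list_of_nat)
    also have "take j (rev (sort a)) = rev (drop (length a - j) (sort a))"
      by (simp only: take_rev length_sort)
    finally show ?thesis
      by (simp only: sum_list_rev)
  qed
  ultimately show ?thesis
    by (simp flip: of_nat_add)
qed

text \<open>With equal totals, passing to the complement turns bounds on sums of the largest parts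
  into reversed bounds on sums of the smallest parts.\<close>

lemma majorized_by_iff_smallest_sums:
  assumes "length a = length b"
  shows "map real a \<prec>maj map real b \<longleftrightarrow> sum_list a = sum_list b \<and>
    (\<forall>k\<le>length a. sum_list (take k (sort b)) \<le> sum_list (take k (sort a)))"
    (is "?L \<longleftrightarrow> ?R")
proof
  assume L: ?L
  then have sum: "sum_list a = sum_list b"
    using assms partial_sum_decreasing[of "length a" a] partial_sum_decreasing[of "length b" b]
    by (simp add: majorized_by_def)
  have "sum_list (take k (sort b)) \<le> sum_list (take k (sort a))" if "k \<le> length a" for k
  \<comment> \<open>This case corresponds to \<open>j = 0\<close>, which lies outside the range in
    the definition of majorization; both sums are then the totals.\<close>
  proof (cases "k = length a")
    case True
    then show ?thesis
      using sum assms by (metis eq_iff length_sort mset_sort sum_mset_sum_list take_all)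
  next
    case False
    then have "length a - k \<in> {1..length (map real a)}"
      using that by auto
    then have "partial_sum (decreasing (map real a)) (length a - k)
        \<le> partial_sum (decreasing (map real b)) (length a - k)"
      using L unfolding majorized_by_def by blast
    then show ?thesis
      using that assms sum by (simp add: partial_sum_decreasing)
  qed
  with sum show ?R by blast
next
  assume ?R
  then show ?L
    using assms by (auto simp: majorized_by_def partial_sum_decreasing)
qed

section \<open>Consecutive blocks as a set partition\<close>

lemma partial_sum_append:
  assumes "j \<le> length a"
  shows "partial_sum (a @ b) j = partial_sum a j"
  using assms by (simp add: partial_sum_eq_sum_list_take)

lemma block_mean_prod_snoc:
  "block_mean_prod (a @ [k]) Y = block_mean_prod a Y * mean Y {sum_list a + 1..sum_list a + k}"
proof -
  have "block_mean_prod (a @ [k]) Y = (\<Prod>j=1..length a.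
        1 / real ((a @ [k]) ! (j - 1)) * (\<Sum>i=partial_sum (a @ [k]) (j - 1) + 1..partial_sum (a @ [k]) j. Y i))
      * (1 / real k * (\<Sum>i=sum_list a + 1..sum_list a + k. Y i))"
    by (simp add: block_mean_prod_def partial_sum_eq_sum_list_take)
  also have "(\<Prod>j=1..length a.
        1 / real ((a @ [k]) ! (j - 1)) * (\<Sum>i=partial_sum (a @ [k]) (j - 1) + 1..partial_sum (a @ [k]) j. Y i))
      = block_mean_prod a Y"
    unfolding block_mean_prod_def
    by (intro prod.cong refl) (auto simp: nth_append partial_sum_append)
  finally show ?thesis
    by (simp add: mean_def)
qed

text \<open>The blocks are built from the left, each new interval starting after the current total.
  Positive sizes keep the intervals nonempty and hence distinct members of \<open>P\<close>.\<close>

lemma block_partition: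
  assumes "0 \<notin> set a"
  obtains P where "partition_on {1..sum_list a} P" "shape P = mset a"
    "\<And>Y. block_mean_prod a Y = (\<Prod>I\<in>P. mean Y I)"
proof -
  have "\<exists>P. partition_on {1..sum_list a} P \<and> shape P = mset a \<and>
      (\<forall>Y. block_mean_prod a Y = (\<Prod>I\<in>P. mean Y I))"
    using assms
  proof (induction a rule: rev_induct)
    case Nil
    show ?case
      by (intro exI[of _ "{}"]) (auto simp: partition_on_def shape_def block_mean_prod_def)
  next
    case (snoc k a)
    then obtain P where P: "partition_on {1..sum_list a} P" "shape P = mset a"
      "\<And>Y. block_mean_prod a Y = (\<Prod>I\<in>P. mean Y I)"
      by auto
    note fin = partition_on_finite[OF finite_atLeastAtMost P(1)]
    let ?I = "{sum_list a + 1..sum_list a + k}"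
    have k: "0 < k"
      using snoc.prems by auto
    have I: "?I \<notin> P"
      using fin(3)[of ?I] k by auto
    have "disjnt ?I (\<Union>P)" "{1..sum_list a} = {1..sum_list (a @ [k])} - ?I"
      unfolding partition_onD1[OF P(1), symmetric] by (auto simp: disjnt_def)
    then have "partition_on {1..sum_list (a @ [k])} (insert ?I P)"
      using k P(1) by (simp add: partition_on_insert)
    then show ?case
      using I fin P(2,3) by (intro exI[of _ "insert ?I P"]) (auto simp: shape_insert block_mean_prod_snoc)
  qed
  with that show ?thesis by blast
qed

text \<open>Every intermediate multiset has to be realized by a partition of \<open>{1..m}\<close>.
  Positivity and the total \<open>m\<close> are therefore carried back along the chain, starting
  from \<open>T\<close>.\<close>

lemma rtranclp_spread_imp_perm_sum_le:
  assumes "spread\<^sup>*\<^sup>* S T" "0 \<notin># T" "sum_mset T = m"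
    and "partition_on {1..m} P" "partition_on {1..m} Q" "shape P = S" "shape Q = T"
    and "convex_on {0..} \<phi>" "\<And>i. i \<in> {1..m} \<Longrightarrow> 0 \<le> X i"
  shows "perm_sum \<phi> X {1..m} P \<le> perm_sum \<phi> X {1..m} Q"
proof -
  have "0 \<notin># S \<and> sum_mset S = m \<and>
      (\<forall>P. partition_on {1..m} P \<longrightarrow> shape P = S \<longrightarrow> perm_sum \<phi> X {1..m} P \<le> perm_sum \<phi> X {1..m} Q)"
    using assms(1)
  proof (induction rule: converse_rtranclp_induct)
    case base
    have "perm_sum \<phi> X {1..m} P = perm_sum \<phi> X {1..m} Q" if "partition_on {1..m} P" "shape P = T" for P
      using that assms(5,7) by (intro perm_sum_cong_shape) auto
    then show ?case
      using assms(2,3) by simp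
  next
    case (step S S')
    obtain s where s: "mset s = S'"
      using ex_mset by blast
    obtain P' where P': "partition_on {1..m} P'" "shape P' = S'"
      using block_partition[of s] step.IH s by (metis set_mset_mset sum_mset_sum_list)
    have "perm_sum \<phi> X {1..m} P \<le> perm_sum \<phi> X {1..m} Q"
      if "partition_on {1..m} P" "shape P = S" for P
    proof (rule order_trans)
      show "perm_sum \<phi> X {1..m} P \<le> perm_sum \<phi> X {1..m} P'"
        using assms(9) by (intro perm_sum_mono_spread[OF step.hyps(1) finite_atLeastAtMost that(1) P'(1) that(2) P'(2) assms(8)])
      show "perm_sum \<phi> X {1..m} P' \<le> perm_sum \<phi> X {1..m} Q"
        using step.IH P' by blast
    qed
    moreover have "0 \<notin># S" "sum_mset S = m"
      using step.hyps(1) step.IH by (auto elim!: spread.cases)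
    ultimately show ?case by blast
  qed
  then show ?thesis
    using assms(4,6) by blast
qed

subsection \<open>Necessity of majorization\<close>

text \<open>The small values fill exactly the first \<open>j\<close> blocks, whose means are
  \<open>e\<close>; the other means are at most \<open>1\<close>.\<close>

lemma block_mean_prod_le_power:
  assumes "0 \<notin> set a" "j \<le> length a" "0 \<le> e" "e \<le> 1"
  shows "block_mean_prod a (\<lambda>i. if i \<le> sum_list (take j a) then e else 1) \<le> e ^ j"
proof -
  define X :: "nat \<Rightarrow> real" where "X = (\<lambda>i. if i \<le> sum_list (take j a) then e else 1)"
  define f where "f = (\<lambda>i. 1 / real (a ! (i - 1)) * (\<Sum>i=partial_sum a (i - 1) + 1..partial_sum a i. X i))"
  have step: "partial_sum a i = partial_sum a (i - 1) + a ! (i - 1)" "0 < a ! (i - 1)" if "i \<in> {1..length a}" for i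
  proof -
    obtain i' where "i = Suc i'" "i' < length a"
      using \<open>i \<in> {1..length a}\<close> by (cases i) auto
    then show "partial_sum a i = partial_sum a (i - 1) + a ! (i - 1)" "0 < a ! (i - 1)"
      using assms(1) nth_mem[of i' a] by (cases "a ! i'"; simp add: partial_sum_def)+
  qed
  have f: "0 \<le> f i" "f i \<le> (if i \<le> j then e else 1)" if i: "i \<in> {1..length a}" for i
  proof -
    have X: "0 \<le> X l" "X l \<le> 1" for l
      using assms(3,4) by (auto simp: X_def)
    then show "0 \<le> f i"
      unfolding f_def by (intro mult_nonneg_nonneg sum_nonneg) auto
    let ?I = "{partial_sum a (i - 1) + 1..partial_sum a i}"
    have le: "(\<Sum>l\<in>?I. X l) \<le> real (a ! (i - 1)) * (if i \<le> j then e else 1)"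
    proof -
      have "X l \<le> (if i \<le> j then e else 1)" if "l \<in> ?I" for l
      proof (cases "i \<le> j")
        case True
        have "partial_sum a i \<le> partial_sum a j"
          unfolding partial_sum_def using True by (intro sum_mono2) auto
        then have "l \<le> sum_list (take j a)"
          using that partial_sum_eq_sum_list_take[OF assms(2)] by simp
        then show ?thesis using True by (simp add: X_def)
      qed (use X in auto)
      then have "(\<Sum>l\<in>?I. X l) \<le> (\<Sum>l\<in>?I. if i \<le> j then e else 1)"
        by (rule sum_mono)
      also have "\<dots> = real (a ! (i - 1)) * (if i \<le> j then e else 1)"
        using step(1)[OF i] by simp
      finally show ?thesis .
    qed
    then show "f i \<le> (if i \<le> j then e else 1)"
      using step(2)[OF i] by (simp add: f_def divide_le_eq mult.commute)
  qed
  have "block_mean_prod a X = (\<Prod>i=1..length a. f i)"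
    by (simp add: block_mean_prod_def f_def)
  also have "\<dots> \<le> (\<Prod>i=1..length a. if i \<le> j then e else 1)"
    using f by (intro prod_mono) auto
  also have "\<dots> = (\<Prod>i\<in>{1..j}. e)"
    using assms(2) by (intro prod.mono_neutral_cong_right) auto
  finally show ?thesis
    by (simp add: X_def)
qed

text \<open>Let \<open>F\<close> consist of the blocks that carry only the value \<open>e\<close>.
  If there were \<open>j\<close> of them, they would contain at least as many points as the
  \<open>j\<close> smallest parts of \<open>b\<close>, but only \<open>k\<close> points carry
  \<open>e\<close>. A single entry of a block bounds its mean below, by \<open>e / m\<close> in
  \<open>F\<close> and by \<open>1 / m\<close> elsewhere.\<close>

lemma mean_prod_ge_power:
  fixes e :: real
  assumes P: "partition_on {1..m} P" and shape: "shape P = mset b" and \<sigma>: "\<sigma> permutes {1..m}"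
    and k: "k < sum_list (take j (sort b))" and e: "0 < e" "e \<le> 1" and m: "0 < m"
  shows "e ^ (j - 1) / real m ^ length b \<le> (\<Prod>I\<in>P. mean (\<lambda>i. if \<sigma> i \<le> k then e else 1) I)"
proof -
  define Y where "Y = (\<lambda>i. if \<sigma> i \<le> k then e else 1)"
  note fin = partition_on_finite[OF finite_atLeastAtMost P]
  define F where "F = {I \<in> P. \<forall>i\<in>I. \<sigma> i \<le> k}"
  have F: "F \<subseteq> P" "finite F"
    using fin(1) by (auto simp: F_def)
  have cardP: "card P = length b"
    using arg_cong[OF shape, of size] by (simp add: shape_def)
  have "card F < j"
  proof (rule ccontr)
    assume "\<not> card F < j"
    then obtain F' where F': "F' \<subseteq> F" "card F' = j"
      using obtain_subset_with_card_n[of j F] by (metis not_less)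
    have finF': "finite F'"
      using F F' finite_subset by blast
    have "shape F' \<subseteq># mset b"
      unfolding shape[symmetric] shape_def using F F' fin(1)
      by (intro image_mset_subseteq_mono) (auto simp: subset_imp_msubset_mset_set)
    then have "shape F' \<subseteq># mset (sort b)" "size (shape F') = j"
      using F'(2) by (simp_all add: shape_def)
    then have "sum_list (take j (sort b)) \<le> sum_mset (shape F')"
      using sum_list_take_sorted_le[of "sort b" "shape F'"] by simp
    also have "\<dots> = (\<Sum>I\<in>F'. card I)"
      by (simp add: shape_def sum_unfold_sum_mset)
    also have "\<dots> = card (\<Union>F')"
      using F F' fin partition_onD2[OF P]
      by (intro card_Union_disjoint[symmetric]) (auto intro: pairwise_subset)
    also have "\<dots> \<le> card {1..k}"
    proof (rule card_inj_on_le)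
      show "inj_on \<sigma> (\<Union>F')"
        using permutes_inj[OF \<sigma>] by (rule inj_on_subset) simp
      show "\<sigma> ` \<Union>F' \<subseteq> {1..k}"
      proof
        fix y assume "y \<in> \<sigma> ` \<Union>F'"
        then obtain I i where "I \<in> F'" "i \<in> I" "y = \<sigma> i"
          by auto
        then have "I \<in> P" "\<sigma> i \<le> k"
          using F' by (auto simp: F_def)
        then have "i \<in> {1..m}"
          using fin(3) \<open>i \<in> I\<close> by blast
        then show "y \<in> {1..k}"
          using permutes_in_image[OF \<sigma>, of i] \<open>y = \<sigma> i\<close> \<open>\<sigma> i \<le> k\<close> by auto
      qed
    qed simp
    finally show False
      using k by simp
  qed
  have mean: "(if I \<in> F then e else 1) / m \<le> mean Y I" if I: "I \<in> P" for I
  proof -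
    have cardI: "0 < card I" "card I \<le> m" "finite I"
      using fin(2-4)[OF I] card_mono[of "{1..m}" I] by auto
    have Y: "0 \<le> Y i" for i
      using e by (simp add: Y_def)
    obtain i where i: "i \<in> I" "(if I \<in> F then e else 1) \<le> Y i"
    proof (cases "I \<in> F")
      case True
      then show ?thesis
        using that cardI by (fastforce simp: F_def Y_def card_gt_0_iff)
    next
      case False
      then obtain i where "i \<in> I" "\<not> \<sigma> i \<le> k"
        using I by (auto simp: F_def)
      then show ?thesis
        using that[of i] False by (simp add: Y_def)
    qed
    have "(if I \<in> F then e else 1) / m \<le> Y i / m"
      using i(2) by (rule divide_right_mono) simp
    also have "\<dots> \<le> Y i / card I"
      using cardI Y by (intro divide_left_mono) auto
    also have "\<dots> \<le> mean Y I"
      unfolding mean_def using i(1) cardI Y by (intro divide_right_mono member_le_sum) auto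
    finally show ?thesis .
  qed
  have "e ^ (j - 1) / real m ^ length b \<le> e ^ card F / real m ^ length b"
    using e m \<open>card F < j\<close> by (intro divide_right_mono power_decreasing) auto
  also have "\<dots> = (\<Prod>I\<in>P. (if I \<in> F then e else 1) / m)"
  proof -
    have "(\<Prod>I\<in>P. if I \<in> F then e else 1) = (\<Prod>I\<in>F. e)"
      using F fin(1) by (intro prod.mono_neutral_cong_right) auto
    then show ?thesis
      by (simp add: prod_dividef cardP)
  qed
  also have "\<dots> \<le> (\<Prod>I\<in>P. mean Y I)"
    using mean e by (intro prod_mono) auto
  finally show ?thesis
    by (simp add: Y_def)
qed

text \<open>A maximum of two affine functions; it is positive exactly below the threshold
  \<open>d\<close>.\<close>

lemma convex_on_hinge: "convex_on {0..} (\<lambda>t::real. max 0 (d - t))"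
proof (rule convex_onI)
  fix t x y :: real assume t: "0 < t" "t < 1"
  have "d - ((1 - t) * x + t * y) = (1 - t) * (d - x) + t * (d - y)"
    by (simp add: algebra_simps)
  also have "\<dots> \<le> (1 - t) * max 0 (d - x) + t * max 0 (d - y)"
    using t by (intro add_mono mult_left_mono) auto
  finally show "max 0 (d - ((1 - t) *\<^sub>R x + t *\<^sub>R y)) \<le> (1 - t) * max 0 (d - x) + t * max 0 (d - y)"
    using t by simp
qed (simp add: convex_real_interval)

lemma sum_block_mean_prod_eq_perm_sum:
  assumes "\<And>Y. block_mean_prod a Y = (\<Prod>I\<in>P. mean Y I)"
  shows "(\<Sum>\<sigma> | \<sigma> permutes M. \<phi> (block_mean_prod a (\<lambda>i. X (\<sigma> i)))) = perm_sum \<phi> X M P"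
  by (simp add: perm_sum_def assms comp_def)

lemma smallest_sums_le_of_sum_permutes_le:
  assumes m: "0 < m" and a: "is_partition m n a" and b: "is_partition m n b" and j: "j \<le> n"
    and le: "\<And>(X :: nat \<Rightarrow> real) \<phi> :: real \<Rightarrow> real. (\<forall>i\<in>{1..m}. 0 \<le> X i) \<Longrightarrow> convex_on {0..} \<phi> \<Longrightarrow>
      (\<Sum>\<sigma> | \<sigma> permutes {1..m}. \<phi> (block_mean_prod a (\<lambda>i. X (\<sigma> i))))
        \<le> (\<Sum>\<sigma> | \<sigma> permutes {1..m}. \<phi> (block_mean_prod b (\<lambda>i. X (\<sigma> i))))"
  shows "sum_list (take j (sort b)) \<le> sum_list (take j (sort a))"
proof (rule ccontr)
  assume "\<not> ?thesis"
  then have k: "sum_list (take j (sort a)) < sum_list (take j (sort b))"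
    by simp
  define k where "k = sum_list (take j (sort a))"
  \<comment> \<open>\<open>d\<close> is the lower bound for all products of \<open>b\<close>, and
    \<open>e\<close> is small enough that \<open>e * m ^ n < 1\<close>, which puts
    \<open>e ^ j\<close> below \<open>d\<close>.\<close>
  define e d where "e = 1 / (2 * real m ^ n)" and "d = e ^ (j - 1) / real m ^ n"
  define X :: "nat \<Rightarrow> real" where "X = (\<lambda>i. if i \<le> k then e else 1)"
  define \<phi> where "\<phi> = (\<lambda>t::real. max 0 (d - t))"
  have "1 \<le> real m ^ n"
    using m by (intro one_le_power) simp
  then have e: "0 < e" "e \<le> 1" "e * real m ^ n < 1"
    by (auto simp: e_def divide_le_eq m)
  \<comment> \<open>For \<open>j = 0\<close> both sums would vanish; hence \<open>j - 1\<close> is a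
    true predecessor.\<close>
  have "j \<noteq> 0"
    using k by (auto intro: ccontr)
  then have "e ^ j * real m ^ n = e ^ (j - 1) * (e * real m ^ n)"
    by (cases j) auto
  also have "\<dots> < e ^ (j - 1) * 1"
    using e by (intro mult_strict_left_mono) auto
  finally have less: "e ^ j < d"
    using m by (simp add: d_def less_divide_eq)
  have sa: "sum_list (sort a) = m" "length (sort a) = n" "0 \<notin> set (sort a)"
    using a by (auto simp: is_partition_def simp flip: sum_mset_sum_list)
  obtain P where P: "partition_on {1..m} P" "shape P = mset a" "\<And>Y. block_mean_prod a Y = (\<Prod>I\<in>P. mean Y I)"
    using block_partition[of a] a by (auto simp: is_partition_def)
  \<comment> \<open>The upper bound needs the smallest blocks first, so \<open>a\<close> is sorted;
    this leaves the permutation sum unchanged.\<close>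
  obtain P' where P': "partition_on {1..m} P'" "shape P' = mset a"
      "\<And>Y. block_mean_prod (sort a) Y = (\<Prod>I\<in>P'. mean Y I)"
    using block_partition[of "sort a"] sa by (metis mset_sort)
  obtain Q where Q: "partition_on {1..m} Q" "shape Q = mset b" "\<And>Y. block_mean_prod b Y = (\<Prod>I\<in>Q. mean Y I)"
    using block_partition[of b] b by (auto simp: is_partition_def)
  have "0 < \<phi> (block_mean_prod (sort a) (\<lambda>i. X (id i)))"
  proof -
    have "block_mean_prod (sort a) X \<le> e ^ j"
      unfolding X_def k_def using sa j e by (intro block_mean_prod_le_power) auto
    with less show ?thesis by (simp add: \<phi>_def)
  qed
  \<comment> \<open>The hinge is nonnegative, so the positive term of the identity permutation
    already makes the whole sum positive, whereas every term for \<open>b\<close> vanishes.\<close>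
  also have "\<dots> \<le> (\<Sum>\<sigma> | \<sigma> permutes {1..m}. \<phi> (block_mean_prod (sort a) (\<lambda>i. X (\<sigma> i))))"
  proof (rule member_le_sum)
    show "id \<in> {\<sigma>. \<sigma> permutes {1..m}}"
      unfolding mem_Collect_eq by (rule permutes_id)
  qed (simp_all add: \<phi>_def finite_permutations)
  also have "\<dots> = (\<Sum>\<sigma> | \<sigma> permutes {1..m}. \<phi> (block_mean_prod a (\<lambda>i. X (\<sigma> i))))"
    unfolding sum_block_mean_prod_eq_perm_sum[OF P(3)] sum_block_mean_prod_eq_perm_sum[OF P'(3)]
    using P P' by (intro perm_sum_cong_shape) auto
  also have "\<dots> \<le> (\<Sum>\<sigma> | \<sigma> permutes {1..m}. \<phi> (block_mean_prod b (\<lambda>i. X (\<sigma> i))))"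
    using e convex_on_hinge by (intro le) (auto simp: X_def \<phi>_def)
  also have "\<dots> = 0"
  proof (rule sum.neutral, rule ballI)
    fix \<sigma> assume \<sigma>: "\<sigma> \<in> {\<sigma>. \<sigma> permutes {1..m}}"
    have "e ^ (j - 1) / real m ^ length b \<le> (\<Prod>I\<in>Q. mean (\<lambda>i. if \<sigma> i \<le> k then e else 1) I)"
      using \<sigma> k j b e m by (intro mean_prod_ge_power[OF Q(1,2)]) (auto simp: k_def is_partition_def)
    then show "\<phi> (block_mean_prod b (\<lambda>i. X (\<sigma> i))) = 0"
      using b by (simp add: \<phi>_def Q(3) X_def d_def is_partition_def)
  qed
  finally show False by simp
qed

section \<open>Equivalence of the inequality with majorization\<close>

theorem theorem1:
  fixes m n :: nat and a b :: "nat list"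
  assumes "0 < m" and "0 < n"
    and "is_partition m n a" and "is_partition m n b"
  shows "(\<forall>(X :: nat \<Rightarrow> real) (\<phi> :: real \<Rightarrow> real).
            (\<forall>i\<in>{1..m}. 0 \<le> X i) \<longrightarrow> convex_on {0..} \<phi> \<longrightarrow>
            (\<Sum>\<sigma> | \<sigma> permutes {1..m}. \<phi> (block_mean_prod a (\<lambda>i. X (\<sigma> i))))
              \<le> (\<Sum>\<sigma> | \<sigma> permutes {1..m}. \<phi> (block_mean_prod b (\<lambda>i. X (\<sigma> i)))))
         \<longleftrightarrow> map real a \<prec>maj map real b"
    (is "?L \<longleftrightarrow> ?R")
proof
  assume ?L
  then have "sum_list (take k (sort b)) \<le> sum_list (take k (sort a))" if "k \<le> n" for k
    using that by (intro smallest_sums_le_of_sum_permutes_le[OF assms(1,3,4)]) auto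
  then show ?R
    using assms(3,4) by (subst majorized_by_iff_smallest_sums) (auto simp: is_partition_def)
next
  assume R: ?R
  have ab: "length a = n" "length b = n" "sum_list a = m" "sum_list b = m" "0 \<notin> set a" "0 \<notin> set b"
    using assms(3,4) by (auto simp: is_partition_def)
  have le: "sum_list (take k (sort b)) \<le> sum_list (take k (sort a))" if "k \<le> n" for k
    using R that ab majorized_by_iff_smallest_sums[of a b] by auto
  \<comment> \<open>The chain is built from the smallest part upwards and so starts from
    \<open>sort a\<close>; passing to multisets forgets the order again.\<close>
  have "spread\<^sup>*\<^sup>* (mset (sort a)) (mset b)"
  proof (rule rtranclp_spread_if_smallest_sums_le)
    show "sum_mset (mset b) = sum_list (sort a)"
      using ab by (metis mset_sort sum_mset_sum_list)
    show "\<exists>C. C \<subseteq># mset b \<and> size C = k \<and> sum_mset C \<le> sum_list (take k (sort a))"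
      if "k \<le> length (sort a)" for k
      using that le[of k] ab mset_take_subseteq[of k "sort b"]
      by (intro exI[of _ "mset (take k (sort b))"]) (auto simp: sum_mset_sum_list)
  qed (use ab in auto)
  then have ch: "spread\<^sup>*\<^sup>* (mset a) (mset b)"
    by simp
  obtain P where P: "partition_on {1..m} P" "shape P = mset a" "\<And>Y. block_mean_prod a Y = (\<Prod>I\<in>P. mean Y I)"
    using block_partition[of a] ab by auto
  obtain Q where Q: "partition_on {1..m} Q" "shape Q = mset b" "\<And>Y. block_mean_prod b Y = (\<Prod>I\<in>Q. mean Y I)"
    using block_partition[of b] ab by auto
  show ?L
    unfolding sum_block_mean_prod_eq_perm_sum[OF P(3)] sum_block_mean_prod_eq_perm_sum[OF Q(3)]
    using ch ab P Q by (intro allI impI rtranclp_spread_imp_perm_sum_le) (auto simp: sum_mset_sum_list)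
qed

end
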